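(* Let $(\mathfrak g,\mu,T)$ be a Rota-Baxter $3$-Lie algebra of weight $\lambda$ and let $(\mathfrak g[[t]],\mu_t,T_t)$, with $\mu_t=\sum_{i\ge0}\mu_it^i$ and $T_t=\sum_{i\ge0}T_it^i$, be a $1$-parameter formal deformation of $(\mathfrak g,\mu,T)$. Then $(\mu_1,T_1)$ is a $2$-cocycle in the cochain complex of the Rota-Baxter $3$-Lie algebra $(\mathfrak g,\mu,T)$ with coefficients in its adjoint representation.
   Context: Let $k$ be a field of characteristic $0$; vector spaces are over $k$; $\lambda\in k$. A $3$-Lie algebra is a vector space $\mathfrak g$ with a linear map $\mu=[\cdot,\cdot,\cdot]:\wedge^3\mathfrak g\to\mathfrak g$ such that $[x_1,x_2,[x_3,x_4,x_5]]=[[x_1,x_2,x_3],x_4,x_5]+[x_3,[x_1,x_2,x_4],x_5]+[x_3,x_4,[x_1,x_2,x_5]]$. A Rota-Baxter $3$-Lie algebra of weight $\lambda$ is a $3$-Lie algebra with a linear map $T:\mathfrak g\to\mathfrak g$ such that $[T(x),T(y),T(z)]=T([x,y,z]_T)$, where $[x,y,z]_T:=[T(x),T(y),z]+[T(x),y,T(z)]+[x,T(y),T(z)]+\lambda[T(x),y,z]+\lambda[x,T(y),z]+\lambda[x,y,T(z)]+\lambda^2[x,y,z]$. The same definitions are used over the ring $k[[t]]$. A $1$-parameter formal deformation of $(\mathfrak g,\mu,T)$ is a pair of power series $\mu_t=\sum_{i\ge0}\mu_it^i$, $T_t=\sum_{i\ge0}T_it^i$ with $\mu_i\in\mathrm{Hom}(\wedge^3\mathfrak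 g,\mathfrak g)$, $T_i\in\mathrm{Hom}(\mathfrak g,\mathfrak g)$, which (extended $k[[t]]$-linearly) endow $\mathfrak g[[t]]$ with the structure of a Rota-Baxter $3$-Lie algebra of weight $\lambda$ over $k[[t]]$, and such that $(\mu_0,T_0)=(\mu,T)$. 2-cocycles (adjoint coefficients). Put $\rho(x,y)z=[x,y,z]$ and $\rho_T(x,y)z=[T(x),T(y),z]-T\big([T(x),y,z]+[x,T(y),z]+\lambda[x,y,z]\big)$. The space of $2$-cochains is $\mathrm{Hom}(\wedge^3\mathfrak g,\mathfrak g)\oplus\mathrm{Hom}(\mathfrak g,\mathfrak g)$, with differential $d^2(f,g)=(\delta^2f,\,-\partial^1g-\Phi^2f)$, where $(\delta^2f)(x_1,\dots,x_5)=-f([x_1,x_2,x_3],x_4,x_5)-f(x_3,[x_1,x_2,x_4],x_5)-f(x_3,x_4,[x_1,x_2,x_5])+f(x_1,x_2,[x_3,x_4,x_5])+\rho(x_1,x_2)f(x_3,x_4,x_5)-\rho(x_3,x_4)f(x_1,x_2,x_5)-\rho(x_4,x_5)f(x_1,x_2,x_3)-\rho(x_5,x_3)f(x_1,x_2,x_4)$; $(\partial^1g)(x,y,z)=-g([x,y,z]_T)+\rho_T(x,y)g(z)+\rho_T(y,z)g(x)+\rho_T(z,x)g(y)$; $(\Phi^2f)(x,y,z)=f(T(x),T(y),T(z))-T\big(f(T(x),T(y),z)+f(T(x),y,T(z))+f(x,T(y),T(z))+\lambda f(T(x),y,z)+\lambda f(x,T(y),z)+\lambda f(x,y,T(z))+\lambda^2f(x,y,z)\big)$.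 A $2$-cocycle is a pair $(f,g)$ with $d^2(f,g)=0$. *)

theory Defs
  imports "HOL-Computational_Algebra.Formal_Power_Series"
begin

section \<open>Rota-Baxter 3-Lie algebras over a commutative ring\<close>

text \<open>
  The structures are defined over an arbitrary commutative ring, because they are used both over a
  field \<open>k\<close> and over the ring \<open>k[[t]]\<close>.  The map \<open>s\<close> is always the scalar multiplication.
\<close>

text \<open>\<open>Hom(\<And>\<^sup>3 V, V)\<close>, presented as the alternating trilinear maps.\<close>

definition alt3_map ::
    "('a::comm_ring_1 \<Rightarrow> 'v::ab_group_add \<Rightarrow> 'v) \<Rightarrow> ('v \<Rightarrow> 'v \<Rightarrow> 'v \<Rightarrow> 'v) \<Rightarrow> bool" where
  "alt3_map s f \<longleftrightarrow>
     (\<forall>y z. module_hom s s (\<lambda>x. f x y z)) \<and>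
     (\<forall>x z. module_hom s s (\<lambda>y. f x y z)) \<and>
     (\<forall>x y. module_hom s s (\<lambda>z. f x y z)) \<and>
     (\<forall>x z. f x x z = 0) \<and> (\<forall>x y. f x y y = 0) \<and> (\<forall>x y. f x y x = 0)"

locale three_lie_algebra = module s
  for s :: "'a::comm_ring_1 \<Rightarrow> 'v::ab_group_add \<Rightarrow> 'v" +
  fixes br :: "'v \<Rightarrow> 'v \<Rightarrow> 'v \<Rightarrow> 'v"
  assumes bracket_alt3: "alt3_map s br"
    and fundamental_identity:
      "br x1 x2 (br x3 x4 x5) =
         br (br x1 x2 x3) x4 x5 + br x3 (br x1 x2 x4) x5 + br x3 x4 (br x1 x2 x5)"

definition rb_bracket ::
    "('a::comm_ring_1 \<Rightarrow> 'v::ab_group_add \<Rightarrow> 'v) \<Rightarrow> 'a \<Rightarrow> ('v \<Rightarrow> 'v \<Rightarrow> 'v \<Rightarrow> 'v) \<Rightarrow> ('v \<Rightarrow> 'v)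
      \<Rightarrow> 'v \<Rightarrow> 'v \<Rightarrow> 'v \<Rightarrow> 'v" where
  "rb_bracket s l br T x y z =
     br (T x) (T y) z + br (T x) y (T z) + br x (T y) (T z)
     + s l (br (T x) y z) + s l (br x (T y) z) + s l (br x y (T z))
     + s (l\<^sup>2) (br x y z)"

locale rota_baxter_three_lie_algebra = three_lie_algebra s br
  for s :: "'a::comm_ring_1 \<Rightarrow> 'v::ab_group_add \<Rightarrow> 'v"
    and br :: "'v \<Rightarrow> 'v \<Rightarrow> 'v \<Rightarrow> 'v" +
  fixes T :: "'v \<Rightarrow> 'v" and l :: 'a
  assumes operator_linear: "module_hom s s T"
    and rota_baxter: "br (T x) (T y) (T z) = T (rb_bracket s l br T x y z)"

section \<open>Formal deformations\<close>

text \<open>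
  The \<open>k[[t]]\<close>-module \<open>V[[t]]\<close> is the type \<^typ>\<open>'v fps\<close>; the type constructor \<^type>\<open>fps\<close> makes
  sense for any additive group of coefficients, only the scalar multiplication has to be supplied.
\<close>

definition fps_scale ::
    "('k::comm_ring_1 \<Rightarrow> 'v::ab_group_add \<Rightarrow> 'v) \<Rightarrow> 'k fps \<Rightarrow> 'v fps \<Rightarrow> 'v fps" where
  "fps_scale s a v = Abs_fps (\<lambda>n. \<Sum>i\<le>n. s (fps_nth a i) (fps_nth v (n - i)))"

lemma module_fps_scale:
  assumes "module s"
  shows "module (fps_scale s)"
proof -
  interpret module s by fact
  show ?thesis
  proof
    fix a b :: "'a fps" and x y :: "'b fps"
    show "fps_scale s a (x + y) = fps_scale s a x + fps_scale s a y"
      by (simp add: fps_eq_iff fps_scale_def scale_right_distrib sum.distrib)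
    show "fps_scale s (a + b) x = fps_scale s a x + fps_scale s b x"
      by (simp add: fps_eq_iff fps_scale_def scale_left_distrib sum.distrib)
    show "fps_scale s 1 x = x"
    proof (rule fps_ext)
      fix n
      have "(\<Sum>i\<le>n. s (fps_nth 1 i) (fps_nth x (n - i))) = (\<Sum>i\<le>n. if i = 0 then fps_nth x n else 0)"
        by (rule sum.cong) auto
      then show "fps_nth (fps_scale s 1 x) n = fps_nth x n" by (simp add: fps_scale_def)
    qed
    show "fps_scale s a (fps_scale s b x) = fps_scale s (a * b) x"
    proof (rule fps_ext)
      fix n
      have "(\<Sum>i\<le>n. \<Sum>j\<le>n - i. s (fps_nth a i * fps_nth b j) (fps_nth x (n - i - j)))
          = (\<Sum>k\<le>n. \<Sum>i\<le>k. s (fps_nth a i * fps_nth b (k - i)) (fps_nth x (n - i - (k - i))))"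
        by (subst (1 2) sum.Sigma, simp_all, rule sum.reindex_bij_witness[where j="\<lambda>(i, j). (i+j, i)" and i="\<lambda>(k, i). (i, k - i)"]) auto
      then show "fps_nth (fps_scale s a (fps_scale s b x)) n = fps_nth (fps_scale s (a * b) x) n"
        by (simp add: fps_scale_def fps_mult_nth scale_sum_right scale_sum_left atLeast0AtMost)
    qed
  qed
qed

text \<open>
  The \<open>k[[t]]\<close>-linear extensions of \<open>\<Sum>\<^sub>i T\<^sub>i t\<^sup>i\<close> and \<open>\<Sum>\<^sub>i \<mu>\<^sub>i t\<^sup>i\<close> to \<open>V[[t]]\<close>: the coefficient of
  \<open>t\<^sup>n\<close> collects all terms whose exponents add up to \<open>n\<close>.
\<close>

definition extend1 :: "(nat \<Rightarrow> 'v \<Rightarrow> 'v) \<Rightarrow> 'v::ab_group_add fps \<Rightarrow> 'v fps" where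
  "extend1 Ts x = Abs_fps (\<lambda>n. \<Sum>i\<le>n. Ts i (fps_nth x (n - i)))"

definition extend3 ::
    "(nat \<Rightarrow> 'v \<Rightarrow> 'v \<Rightarrow> 'v \<Rightarrow> 'v) \<Rightarrow> 'v::ab_group_add fps \<Rightarrow> 'v fps \<Rightarrow> 'v fps \<Rightarrow> 'v fps" where
  "extend3 ms x y z = Abs_fps (\<lambda>n. \<Sum>i\<le>n. \<Sum>p\<le>n - i. \<Sum>q\<le>n - i - p.
     ms i (fps_nth x p) (fps_nth y q) (fps_nth z (n - i - p - q)))"

definition formal_deformation ::
    "('k::comm_ring_1 \<Rightarrow> 'v::ab_group_add \<Rightarrow> 'v) \<Rightarrow> 'k
      \<Rightarrow> ('v \<Rightarrow> 'v \<Rightarrow> 'v \<Rightarrow> 'v) \<Rightarrow> ('v \<Rightarrow> 'v)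
      \<Rightarrow> (nat \<Rightarrow> 'v \<Rightarrow> 'v \<Rightarrow> 'v \<Rightarrow> 'v) \<Rightarrow> (nat \<Rightarrow> 'v \<Rightarrow> 'v) \<Rightarrow> bool" where
  "formal_deformation s l br T ms Ts \<longleftrightarrow>
     (\<forall>i. alt3_map s (ms i)) \<and> (\<forall>i. module_hom s s (Ts i)) \<and>
     rota_baxter_three_lie_algebra (fps_scale s) (extend3 ms) (extend1 Ts) (fps_const l) \<and>
     ms 0 = br \<and> Ts 0 = T"

section \<open>2-cocycles with adjoint coefficients\<close>

definition adj_rho :: "('v \<Rightarrow> 'v \<Rightarrow> 'v \<Rightarrow> 'v) \<Rightarrow> 'v \<Rightarrow> 'v \<Rightarrow> 'v \<Rightarrow> 'v" where
  "adj_rho br x y z = br x y z"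

definition adj_rho_T ::
    "('a::comm_ring_1 \<Rightarrow> 'v::ab_group_add \<Rightarrow> 'v) \<Rightarrow> 'a \<Rightarrow> ('v \<Rightarrow> 'v \<Rightarrow> 'v \<Rightarrow> 'v) \<Rightarrow> ('v \<Rightarrow> 'v)
      \<Rightarrow> 'v \<Rightarrow> 'v \<Rightarrow> 'v \<Rightarrow> 'v" where
  "adj_rho_T s l br T x y z =
     br (T x) (T y) z - T (br (T x) y z + br x (T y) z + s l (br x y z))"

definition delta2 ::
    "('v \<Rightarrow> 'v \<Rightarrow> 'v \<Rightarrow> 'v::ab_group_add) \<Rightarrow> ('v \<Rightarrow> 'v \<Rightarrow> 'v \<Rightarrow> 'v)
      \<Rightarrow> 'v \<Rightarrow> 'v \<Rightarrow> 'v \<Rightarrow> 'v \<Rightarrow> 'v \<Rightarrow> 'v" where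
  "delta2 br f x1 x2 x3 x4 x5 =
     - f (br x1 x2 x3) x4 x5 - f x3 (br x1 x2 x4) x5 - f x3 x4 (br x1 x2 x5)
     + f x1 x2 (br x3 x4 x5)
     + adj_rho br x1 x2 (f x3 x4 x5) - adj_rho br x3 x4 (f x1 x2 x5)
     - adj_rho br x4 x5 (f x1 x2 x3) - adj_rho br x5 x3 (f x1 x2 x4)"

definition partial1 ::
    "('a::comm_ring_1 \<Rightarrow> 'v::ab_group_add \<Rightarrow> 'v) \<Rightarrow> 'a \<Rightarrow> ('v \<Rightarrow> 'v \<Rightarrow> 'v \<Rightarrow> 'v) \<Rightarrow> ('v \<Rightarrow> 'v)
      \<Rightarrow> ('v \<Rightarrow> 'v) \<Rightarrow> 'v \<Rightarrow> 'v \<Rightarrow> 'v \<Rightarrow> 'v" where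
  "partial1 s l br T g x y z =
     - g (rb_bracket s l br T x y z)
     + adj_rho_T s l br T x y (g z) + adj_rho_T s l br T y z (g x) + adj_rho_T s l br T z x (g y)"

definition Phi2 ::
    "('a::comm_ring_1 \<Rightarrow> 'v::ab_group_add \<Rightarrow> 'v) \<Rightarrow> 'a \<Rightarrow> ('v \<Rightarrow> 'v)
      \<Rightarrow> ('v \<Rightarrow> 'v \<Rightarrow> 'v \<Rightarrow> 'v) \<Rightarrow> 'v \<Rightarrow> 'v \<Rightarrow> 'v \<Rightarrow> 'v" where
  "Phi2 s l T f x y z =
     f (T x) (T y) (T z)
     - T (f (T x) (T y) z + f (T x) y (T z) + f x (T y) (T z)
          + s l (f (T x) y z) + s l (f x (T y) z) + s l (f x y (T z))
          + s (l\<^sup>2) (f x y z))"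

definition cochain2 ::
    "('a::comm_ring_1 \<Rightarrow> 'v::ab_group_add \<Rightarrow> 'v)
      \<Rightarrow> (('v \<Rightarrow> 'v \<Rightarrow> 'v \<Rightarrow> 'v) \<times> ('v \<Rightarrow> 'v)) set" where
  "cochain2 s = {(f, g). alt3_map s f \<and> module_hom s s g}"

definition d2 ::
    "('a::comm_ring_1 \<Rightarrow> 'v::ab_group_add \<Rightarrow> 'v) \<Rightarrow> 'a \<Rightarrow> ('v \<Rightarrow> 'v \<Rightarrow> 'v \<Rightarrow> 'v) \<Rightarrow> ('v \<Rightarrow> 'v)
      \<Rightarrow> ('v \<Rightarrow> 'v \<Rightarrow> 'v \<Rightarrow> 'v) \<times> ('v \<Rightarrow> 'v)
      \<Rightarrow> ('v \<Rightarrow> 'v \<Rightarrow> 'v \<Rightarrow> 'v \<Rightarrow> 'v \<Rightarrow> 'v) \<times> ('v \<Rightarrow> 'v \<Rightarrow> 'v \<Rightarrow> 'v)" where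
  "d2 s l br T = (\<lambda>(f, g).
     (delta2 br f, \<lambda>x y z. - partial1 s l br T g x y z - Phi2 s l T f x y z))"

definition cocycles2 ::
    "('a::comm_ring_1 \<Rightarrow> 'v::ab_group_add \<Rightarrow> 'v) \<Rightarrow> 'a \<Rightarrow> ('v \<Rightarrow> 'v \<Rightarrow> 'v \<Rightarrow> 'v) \<Rightarrow> ('v \<Rightarrow> 'v)
      \<Rightarrow> (('v \<Rightarrow> 'v \<Rightarrow> 'v \<Rightarrow> 'v) \<times> ('v \<Rightarrow> 'v)) set" where
  "cocycles2 s l br T =
     {c \<in> cochain2 s. d2 s l br T c = (\<lambda>x1 x2 x3 x4 x5. 0, \<lambda>x y z. 0)}"

end

theory Submission
  imports Defs
begin

text \<open>
  A pair \<open>(\<mu>\<^sub>1, T\<^sub>1)\<close> is a 2-cocycle exactly when the fundamental identity and the Rota-Baxter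
  identity of the deformed structure hold modulo \<open>t\<^sup>2\<close> on constant power series: the coefficient
  of \<open>t\<close> in the former is \<open>\<delta>\<^sup>2 \<mu>\<^sub>1 = 0\<close>, and in the latter
  \<open>\<partial>\<^sup>1 T\<^sub>1 + \<Phi>\<^sup>2 \<mu>\<^sub>1 = 0\<close>, once the arguments of the alternating bracket have been
  permuted cyclically.
\<close>

lemma alt3_map_add:
  assumes "alt3_map s f"
  shows "f (a + b) y z = f a y z + f b y z"
    and "f x (a + b) z = f x a z + f x b z"
    and "f x y (a + b) = f x y a + f x y b"
proof -
  have hom: "module_hom s s (\<lambda>u. f u y z)" "module_hom s s (\<lambda>u. f x u z)"
    "module_hom s s (\<lambda>u. f x y u)"
    using assms unfolding alt3_map_def by blast+
  show "f (a + b) y z = f a y z + f b y z"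
    by (rule module_hom.add[OF hom(1)])
  show "f x (a + b) z = f x a z + f x b z"
    by (rule module_hom.add[OF hom(2)])
  show "f x y (a + b) = f x y a + f x y b"
    by (rule module_hom.add[OF hom(3)])
qed

lemma alt3_map_zero:
  assumes "alt3_map s f"
  shows "f 0 y z = 0" and "f x 0 z = 0" and "f x y 0 = 0"
  using alt3_map_add(1)[OF assms, of 0 0 y z] alt3_map_add(2)[OF assms, of x 0 0 z]
    alt3_map_add(3)[OF assms, of x y 0 0]
  by simp_all

text \<open>Polarizing the vanishing on repeated arguments gives antisymmetry in the first two and
  in the last two slots. A cyclic rotation is a product of two such swaps, so the signs
  cancel.\<close>

lemma alt3_map_rotate:
  assumes "alt3_map s f"
  shows "f x y z = f y z x"
proof -
  have van: "f u u w = 0" "f u w w = 0" "f u w u = 0" for u w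
    using assms unfolding alt3_map_def by blast+
  have "f (x + y) (x + y) z = 0" and "f y (x + z) (x + z) = 0"
    by (rule van)+
  then have "f x y z + f y x z = 0" and "f y x z + f y z x = 0"
    unfolding alt3_map_add[OF assms] by (simp_all add: van add.commute)
  then have "f x y z + f y x z = f y z x + f y x z"
    by (simp only: add.commute[of "f y z x"])
  then show ?thesis
    by (rule add_right_imp_eq)
qed

lemma extend1_nth_0: "fps_nth (extend1 Ts x) 0 = Ts 0 (fps_nth x 0)"
  by (simp add: extend1_def)

lemma extend1_nth_1:
  "fps_nth (extend1 Ts x) 1 = Ts 0 (fps_nth x 1) + Ts 1 (fps_nth x 0)"
  by (simp add: extend1_def atMost_Suc add.commute)

lemma extend3_nth_0:
  "fps_nth (extend3 ms x y z) 0 = ms 0 (fps_nth x 0) (fps_nth y 0) (fps_nth z 0)"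
  by (simp add: extend3_def)

text \<open>The single factor \<open>t\<close> comes either from one of the three arguments or from
  the bracket series itself, hence four terms.\<close>

lemma extend3_nth_1:
  "fps_nth (extend3 ms x y z) 1 =
     ms 0 (fps_nth x 1) (fps_nth y 0) (fps_nth z 0)
     + ms 0 (fps_nth x 0) (fps_nth y 1) (fps_nth z 0)
     + ms 0 (fps_nth x 0) (fps_nth y 0) (fps_nth z 1)
     + ms 1 (fps_nth x 0) (fps_nth y 0) (fps_nth z 0)"
  by (simp add: extend3_def atMost_Suc algebra_simps)

lemma fps_scale_const_nth:
  assumes "module s"
  shows "fps_nth (fps_scale s (fps_const c) v) n = s c (fps_nth v n)"
proof -
  interpret module s by fact
  have "(\<Sum>i\<le>n. s (fps_nth (fps_const c) i) (fps_nth v (n - i)))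
      = (\<Sum>i\<le>n. if i = 0 then s c (fps_nth v n) else 0)"
    by (rule sum.cong) auto
  then show ?thesis
    by (simp add: fps_scale_def)
qed

lemma deformation_delta2:
  assumes def: "formal_deformation s l br T ms Ts"
  shows "delta2 br (ms 1) x1 x2 x3 x4 x5 = 0"
proof -
  interpret D: rota_baxter_three_lie_algebra "fps_scale s" "extend3 ms" "extend1 Ts" "fps_const l"
    using def by (simp add: formal_deformation_def)
  have alt: "alt3_map s br" and ms0: "ms 0 = br"
    using def by (auto simp: formal_deformation_def)
  note zero = alt3_map_zero[OF alt]
  \<comment> \<open>The fundamental identity leaves these inner values of \<open>ms 1\<close> in the
    first and second slots, whereas the adjoint action in \<open>delta2\<close> takes them in the
    third.\<close>
  have rot: "br (ms 1 x1 x2 x3) x4 x5 = br x4 x5 (ms 1 x1 x2 x3)"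
    "br x3 (ms 1 x1 x2 x4) x5 = br x5 x3 (ms 1 x1 x2 x4)"
    by (rule alt3_map_rotate[OF alt], rule alt3_map_rotate[OF alt, symmetric])
  have "fps_nth (extend3 ms (fps_const x1) (fps_const x2)
          (extend3 ms (fps_const x3) (fps_const x4) (fps_const x5))) 1 =
        fps_nth (extend3 ms (extend3 ms (fps_const x1) (fps_const x2) (fps_const x3))
          (fps_const x4) (fps_const x5)
        + extend3 ms (fps_const x3) (extend3 ms (fps_const x1) (fps_const x2) (fps_const x4))
          (fps_const x5)
        + extend3 ms (fps_const x3) (fps_const x4)
          (extend3 ms (fps_const x1) (fps_const x2) (fps_const x5))) 1"
    by (rule arg_cong[OF D.fundamental_identity])
  then show ?thesis
    unfolding fps_add_nth extend3_nth_0 extend3_nth_1 ms0 delta2_def adj_rho_def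
    \<comment> \<open>The simplifier turns \<open>ms 1\<close> into \<open>ms (Suc 0)\<close>, so
      \<open>rot\<close> is restated to match. Constant series have no \<open>t\<close> coefficient,
      and \<open>zero\<close> removes the brackets that contain it.\<close>
    by (simp add: zero rot[unfolded One_nat_def] algebra_simps)
qed

text \<open>In the \<open>t\<close> coefficient of left minus right side of the Rota-Baxter
  identity, the terms with \<open>ms 1\<close> form \<open>Phi2\<close>. The outer
  \<open>Ts 1\<close> gives the first term of \<open>partial1\<close>, and the terms containing
  \<open>Ts 1 z\<close> combine to \<open>adj_rho_T\<close> of \<open>x\<close>, \<open>y\<close>
  applied to \<open>Ts 1 z\<close>; likewise for \<open>x\<close> and \<open>y\<close> after
  rotation.\<close>

lemma deformation_partial1_Phi2:
  assumes mod: "module s"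
    and def: "formal_deformation s l br T ms Ts"
  shows "partial1 s l br T (Ts 1) x y z + Phi2 s l T (ms 1) x y z = 0"
proof -
  interpret module s by fact
  interpret D: rota_baxter_three_lie_algebra "fps_scale s" "extend3 ms" "extend1 Ts" "fps_const l"
    using def by (simp add: formal_deformation_def)
  have alt: "alt3_map s br" and ms0: "ms 0 = br" and Ts0: "Ts 0 = T"
    and hom: "module_hom s s (Ts 0)" "module_hom s s (Ts 1)"
    using def by (auto simp: formal_deformation_def)
  interpret T: module_hom s s T using hom(1) by (simp add: Ts0)
  interpret T1: module_hom s s "Ts 1" by (fact hom(2))
  note zero = alt3_map_zero[OF alt]
  \<comment> \<open>These move \<open>Ts 1 x\<close> and \<open>Ts 1 y\<close> from the third slot,
    where \<open>adj_rho_T\<close> puts them, back to the slots of \<open>x\<close> and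
    \<open>y\<close>.\<close>
  have rotx: "br y' z' (Ts 1 x) = br (Ts 1 x) y' z'"
    and roty: "br z' x' (Ts 1 y) = br x' (Ts 1 y) z'" for x' y' z'
    by (rule alt3_map_rotate[OF alt, symmetric], rule alt3_map_rotate[OF alt])
  let ?L = "extend3 ms (extend1 Ts (fps_const x)) (extend1 Ts (fps_const y))
    (extend1 Ts (fps_const z))"
  let ?R = "extend1 Ts (rb_bracket (fps_scale s) (fps_const l) (extend3 ms) (extend1 Ts)
    (fps_const x) (fps_const y) (fps_const z))"
  have L: "fps_nth ?L 1 =
      br (Ts 1 x) (T y) (T z) + br (T x) (Ts 1 y) (T z) + br (T x) (T y) (Ts 1 z)
      + ms 1 (T x) (T y) (T z)"
    unfolding extend3_nth_1 extend1_nth_0 extend1_nth_1 ms0 Ts0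
    by (simp add: T.zero)
  have R: "fps_nth ?R 1 =
      T (br (Ts 1 x) (T y) z + br (T x) (Ts 1 y) z + ms 1 (T x) (T y) z
        + (br (Ts 1 x) y (T z) + br (T x) y (Ts 1 z) + ms 1 (T x) y (T z))
        + (br x (Ts 1 y) (T z) + br x (T y) (Ts 1 z) + ms 1 x (T y) (T z))
        + s l (br (Ts 1 x) y z + ms 1 (T x) y z)
        + s l (br x (Ts 1 y) z + ms 1 x (T y) z)
        + s l (br x y (Ts 1 z) + ms 1 x y (T z))
        + s (l\<^sup>2) (ms 1 x y z))
      + Ts 1 (rb_bracket s l br T x y z)"
    unfolding rb_bracket_def fps_const_power fps_add_nth extend3_nth_0 extend3_nth_1
      extend1_nth_0 extend1_nth_1 fps_scale_const_nth[OF mod] ms0 Ts0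
    by (simp add: zero T.zero)
  have "partial1 s l br T (Ts 1) x y z + Phi2 s l T (ms 1) x y z = fps_nth ?L 1 - fps_nth ?R 1"
    unfolding L R partial1_def Phi2_def adj_rho_T_def rotx roty
    by (simp add: T.add scale_right_distrib)
  then show ?thesis
    by (simp only: D.rota_baxter diff_self)
qed

theorem proposition4p5:
  fixes s :: "'k::field_char_0 \<Rightarrow> 'g::ab_group_add \<Rightarrow> 'g"
    and l :: 'k
    and br :: "'g \<Rightarrow> 'g \<Rightarrow> 'g \<Rightarrow> 'g" and T :: "'g \<Rightarrow> 'g"
    and ms :: "nat \<Rightarrow> 'g \<Rightarrow> 'g \<Rightarrow> 'g \<Rightarrow> 'g" and Ts :: "nat \<Rightarrow> 'g \<Rightarrow> 'g"
  assumes "vector_space s"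
    and "rota_baxter_three_lie_algebra s br T l"
    and "formal_deformation s l br T ms Ts"
  shows "(ms 1, Ts 1) \<in> cocycles2 s l br T"
proof -
  have "module s"
    by (rule three_lie_algebra.axioms(1)[OF rota_baxter_three_lie_algebra.axioms(1)[OF assms(2)]])
  \<comment> \<open>The second component of \<open>d2\<close> is the negative of the sum already
    shown to vanish.\<close>
  then have "- partial1 s l br T (Ts 1) x y z - Phi2 s l T (ms 1) x y z = 0" for x y z
    using deformation_partial1_Phi2[OF _ assms(3), of x y z]
    by (simp only: diff_conv_add_uminus minus_add_distrib[symmetric] minus_zero)
  moreover have "(ms 1, Ts 1) \<in> cochain2 s"
    using assms(3) by (simp add: formal_deformation_def cochain2_def)
  ultimately show ?thesis
    using deformation_delta2[OF assms(3)]
    unfolding cocycles2_def d2_def by (simp add: fun_eq_iff)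
qed

end
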